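(* Let $\alpha\in(1,2)$ and let $\phi$ be the odd kink, i.e. an odd solution of $$D^\alpha\phi+\phi(\phi^2-1)=0\ \text{ on }\mathbb R,\qquad \lim_{x\to\pm\infty}\phi(x)=\pm1,$$ having the properties listed in the context. Let $\mathcal L_\phi:=D^\alpha+2-3(1-\phi^2)$. Assume, in addition, that the second smallest gap eigenvalue $\lambda_1(\mathcal L_\phi)$ of $\mathcal L_\phi$, if any, is bigger than $1$; that is, $$\lambda_1(\mathcal L_\phi)>1\qquad\text{or}\qquad \mathcal L_\phi|_{\{\phi'\}^\perp}>1 .$$ Then $\phi$ is the unique odd solution in the following sense: if $u\in C^{1,1}_{loc}(\mathbb R)\cap L^\infty(\mathbb R)$ is an odd solution of $D^\alpha u+u(u^2-1)=0$ on $\mathbb R$ with $$\lim_{x\to\pm\infty}u(x)=\pm1,\qquad 1-u^2\in L^2(\mathbb R),\qquad |u(x)|\le1\ \text{ for all }x,$$ then $u(x)=\phi(x)$ for all $x\in\mathbb R$.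
   Context: The Fourier transform is $\hat f(\xi)=\int_{\mathbb R}f(x)e^{-2\pi i x\xi}dx$, and $D^s$ is the operator with Fourier multiplier $(2\pi|\xi|)^s$. For bounded $u\in C^{1,1}_{loc}(\mathbb R)$ and $\alpha\in(0,2)$, $D^\alpha u$ is equivalently given by $D^\alpha u(x)=C_\alpha\,\mathrm{p.v.}\int_{\mathbb R}\frac{u(x)-u(y)}{|x-y|^{1+\alpha}}dy$ with the appropriate constant $C_\alpha>0$. All functions are real-valued. Properties of the odd kink $\phi$ (such a $\phi$ exists for every $\alpha\in(1,2)$): $\phi$ is odd, $\phi\in L^\infty(\mathbb R)\cap\bigcap_{s\ge\alpha/2}\dot H^s(\mathbb R)$ (where $\phi\in\dot H^s$ means $D^s\phi\in L^2$), $\phi\in C^\infty(\mathbb R)$; $|\phi'(x)|\le C(1+|x|)^{-1-\alpha}$ and $|\phi(x)-\mathrm{sgn}(x)|\le C(1+|x|)^{-\alpha}$; $\phi'\in\bigcap_{s\ge0}\dot H^s(\mathbb R)$; $\mathcal L_\phi\ge0$ and $\mathcal L_\phi[\phi']=0$; $\phi'>0$ and $-1<\phi<1$. $\mathcal L_\phi$ is self-adjoint on $L^2(\mathbb R)$ with domain $H^\alpha(\mathbb R)$; its essential spectrum is $[2,\infty)$, and its lowest eigenvalue $\lambda_0=0$ is simple with eigenfunction $\phi'$. Gap eigenvalues are eigenvalues in $[0,2]$. $\mathcal L_\phi|_{\{\phi'\}^\perp}>1$ means $\langle\mathcal L_\phi h,h\rangle>\|h\|_{L^2}^2$ for all nonzero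 $h\in H^\alpha(\mathbb R)$ with $h\perp\phi'$ in $L^2$; this is the same condition as $\lambda_1(\mathcal L_\phi)>1$ (understood as vacuously satisfied if there is no second gap eigenvalue). *)

theory Defs
  imports "HOL-Analysis.Analysis"
begin

definition smooth_fun :: "(real \<Rightarrow> real) \<Rightarrow> bool" where
  "smooth_fun f \<longleftrightarrow> (\<forall>n x. ((deriv ^^ n) f) differentiable (at x))"

definition schwartz :: "(real \<Rightarrow> real) set" where
  "schwartz = {\<psi>. smooth_fun \<psi> \<and>
     (\<forall>m n. bounded (range (\<lambda>x. x ^ m * (deriv ^^ n) \<psi> x)))}"

definition C11_loc :: "(real \<Rightarrow> real) set" where
  "C11_loc = {u. (\<forall>x. u differentiable (at x)) \<and>
     (\<forall>K. compact K \<longrightarrow> (\<exists>L. L-lipschitz_on K (deriv u)))}"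

text \<open>Elements of \<open>L2\<close> are functions, not classes; equality in the Hilbert space is
  equality almost everywhere.\<close>

definition L2 :: "(real \<Rightarrow> real) set" where
  "L2 = {f. f \<in> borel_measurable lborel \<and> integrable lborel (\<lambda>x. (f x)\<^sup>2)}"

definition L2_inner :: "(real \<Rightarrow> real) \<Rightarrow> (real \<Rightarrow> real) \<Rightarrow> real" where
  "L2_inner f g = (LINT x|lborel. f x * g x)"

definition L2_normsq :: "(real \<Rightarrow> real) \<Rightarrow> real" where
  "L2_normsq f = L2_inner f f"

definition fourier :: "(real \<Rightarrow> real) \<Rightarrow> real \<Rightarrow> complex" where
  "fourier f \<xi> = (LINT x|lborel. complex_of_real (f x) * cis (- 2 * pi * x * \<xi>))"

text \<open>The inverse transform below is real for real \<open>\<psi>\<close>, since the multiplier is even; \<open>Re\<close>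
  only adjusts the type.\<close>

definition Ds_schwartz :: "real \<Rightarrow> (real \<Rightarrow> real) \<Rightarrow> real \<Rightarrow> real" where
  "Ds_schwartz s \<psi> x =
     Re (LINT \<xi>|lborel. complex_of_real ((2 * pi * \<bar>\<xi>\<bar>) powr s) * fourier \<psi> \<xi> * cis (2 * pi * x * \<xi>))"

text \<open>The multiplier acts on functions that need not be integrable (such as a kink) by duality
  with Schwartz functions. As \<open>Ds_schwartz s \<psi> x\<close> is \<open>O(\<bar>x\<bar>\<^sup>-\<^sup>1\<^sup>-\<^sup>s)\<close>, the pairing is defined for
  bounded functions if \<open>s > 0\<close>, and for square integrable ones if \<open>s \<ge> 0\<close>.\<close>

definition is_Ds :: "real \<Rightarrow> (real \<Rightarrow> real) \<Rightarrow> (real \<Rightarrow> real) \<Rightarrow> bool" where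
  "is_Ds s f g \<longleftrightarrow> f \<in> borel_measurable lborel \<and> g \<in> borel_measurable lborel \<and>
     (\<forall>\<psi>\<in>schwartz. integrable lborel (\<lambda>x. f x * Ds_schwartz s \<psi> x) \<and>
        integrable lborel (\<lambda>x. g x * \<psi> x) \<and>
        (LINT x|lborel. f x * Ds_schwartz s \<psi> x) = (LINT x|lborel. g x * \<psi> x))"

definition hom_sobolev :: "real \<Rightarrow> (real \<Rightarrow> real) set" where
  "hom_sobolev s = {f. \<exists>g\<in>L2. is_Ds s f g}"

definition sobolev :: "real \<Rightarrow> (real \<Rightarrow> real) set" where
  "sobolev s = L2 \<inter> hom_sobolev s"

text \<open>Determined up to null sets by \<open>is_Ds\<close>; meaningful for \<open>f \<in> hom_sobolev s\<close>.\<close>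

definition Ds :: "real \<Rightarrow> (real \<Rightarrow> real) \<Rightarrow> real \<Rightarrow> real" where
  "Ds s f = (SOME g. g \<in> L2 \<and> is_Ds s f g)"

text \<open>Applying the principal value to \<open>x \<mapsto> cis (k * x)\<close> yields
  \<open>(\<integral> (1 - cos (k * t)) / \<bar>t\<bar>\<^sup>1\<^sup>+\<^sup>\<alpha> dt) * cis (k * x)\<close>, where the integral is \<open>\<bar>k\<bar>\<^sup>\<alpha>\<close> times its value at
  \<open>k = 1\<close>. The constant below is therefore the one for which the symbol is \<open>\<bar>k\<bar>\<^sup>\<alpha>\<close>,
  with \<open>k = 2 * pi * \<xi>\<close>.\<close>

definition C_alpha :: "real \<Rightarrow> real" where
  "C_alpha \<alpha> = 1 / (LINT t|lborel. (1 - cos t) / \<bar>t\<bar> powr (1 + \<alpha>))"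

definition Dpv :: "real \<Rightarrow> (real \<Rightarrow> real) \<Rightarrow> real \<Rightarrow> real" where
  "Dpv \<alpha> u x = C_alpha \<alpha> *
     Lim (at_right 0) (\<lambda>\<epsilon>. LINT y:{y. \<epsilon> < \<bar>x - y\<bar>}|lborel. (u x - u y) / \<bar>x - y\<bar> powr (1 + \<alpha>))"

definition odd_fun :: "(real \<Rightarrow> real) \<Rightarrow> bool" where
  "odd_fun u \<longleftrightarrow> (\<forall>x. u (- x) = - u x)"

definition kink_eq :: "real \<Rightarrow> (real \<Rightarrow> real) \<Rightarrow> bool" where
  "kink_eq \<alpha> u \<longleftrightarrow> (\<forall>x. Dpv \<alpha> u x + u x * ((u x)\<^sup>2 - 1) = 0)"

definition self_adjoint_on ::
  "(real \<Rightarrow> real) set \<Rightarrow> ((real \<Rightarrow> real) \<Rightarrow> real \<Rightarrow> real) \<Rightarrow> bool" where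
  "self_adjoint_on \<D> T \<longleftrightarrow>
     \<D> \<subseteq> L2 \<and> (\<forall>h\<in>\<D>. T h \<in> L2) \<and>
     (\<forall>f\<in>L2. \<forall>e>0. \<exists>h\<in>\<D>. L2_normsq (\<lambda>x. f x - h x) < e) \<and>
     (\<forall>f\<in>L2. \<forall>g\<in>L2. (\<forall>h\<in>\<D>. L2_inner (T h) f = L2_inner h g) \<longleftrightarrow>
        (f \<in> \<D> \<and> (AE x in lborel. T f x = g x)))"

text \<open>Weyl's criterion: \<open>\<mu>\<close> admits a normalised approximate eigensequence without a
  convergent subsequence.\<close>

definition essential_spectrum ::
  "(real \<Rightarrow> real) set \<Rightarrow> ((real \<Rightarrow> real) \<Rightarrow> real \<Rightarrow> real) \<Rightarrow> real set" where
  "essential_spectrum \<D> T = {\<mu>. \<exists>h :: nat \<Rightarrow> real \<Rightarrow> real.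
     (\<forall>n. h n \<in> \<D> \<and> L2_normsq (h n) = 1) \<and>
     (\<lambda>n. L2_normsq (\<lambda>x. T (h n) x - \<mu> * h n x)) \<longlonglongrightarrow> 0 \<and>
     \<not> (\<exists>r f. strict_mono r \<and> f \<in> L2 \<and> (\<lambda>n. L2_normsq (\<lambda>x. h (r n) x - f x)) \<longlonglongrightarrow> 0)}"

definition eigenvalues ::
  "(real \<Rightarrow> real) set \<Rightarrow> ((real \<Rightarrow> real) \<Rightarrow> real \<Rightarrow> real) \<Rightarrow> real set" where
  "eigenvalues \<D> T = {\<mu>. \<exists>h\<in>\<D>. \<not> (AE x in lborel. h x = 0) \<and>
     (AE x in lborel. T h x = \<mu> * h x)}"

definition second_smallest :: "real set \<Rightarrow> real \<Rightarrow> bool" where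
  "second_smallest S \<mu> \<longleftrightarrow> \<mu> \<in> S \<and> (\<exists>\<nu>\<in>S. \<nu> < \<mu> \<and> (\<forall>\<kappa>\<in>S. \<kappa> = \<nu> \<or> \<mu> \<le> \<kappa>))"

definition lin_op :: "real \<Rightarrow> (real \<Rightarrow> real) \<Rightarrow> (real \<Rightarrow> real) \<Rightarrow> real \<Rightarrow> real" where
  "lin_op \<alpha> \<phi> h x = Ds \<alpha> h x + 2 * h x - 3 * (1 - (\<phi> x)\<^sup>2) * h x"

definition gap_eigenvalues :: "real \<Rightarrow> (real \<Rightarrow> real) \<Rightarrow> real set" where
  "gap_eigenvalues \<alpha> \<phi> = eigenvalues (sobolev \<alpha>) (lin_op \<alpha> \<phi>) \<inter> {0..2}"

text \<open>Gap eigenvalues are counted without multiplicity, which is immaterial here because the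
  lowest one is simple. The condition is vacuous if there is no second one.\<close>

definition lambda1_gt_1 :: "real \<Rightarrow> (real \<Rightarrow> real) \<Rightarrow> bool" where
  "lambda1_gt_1 \<alpha> \<phi> \<longleftrightarrow> (\<forall>\<mu>. second_smallest (gap_eigenvalues \<alpha> \<phi>) \<mu> \<longrightarrow> \<mu> > 1)"

definition lin_op_perp_gt_1 :: "real \<Rightarrow> (real \<Rightarrow> real) \<Rightarrow> bool" where
  "lin_op_perp_gt_1 \<alpha> \<phi> \<longleftrightarrow>
     (\<forall>h\<in>sobolev \<alpha>. \<not> (AE x in lborel. h x = 0) \<and> L2_inner h (deriv \<phi>) = 0 \<longrightarrow>
        L2_inner (lin_op \<alpha> \<phi> h) h > L2_normsq h)"

definition odd_kink :: "real \<Rightarrow> (real \<Rightarrow> real) \<Rightarrow> bool" where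
  "odd_kink \<alpha> \<phi> \<longleftrightarrow>
     odd_fun \<phi> \<and> kink_eq \<alpha> \<phi> \<and> (\<phi> \<longlongrightarrow> 1) at_top \<and> (\<phi> \<longlongrightarrow> - 1) at_bot \<and>
     bounded (range \<phi>) \<and> (\<forall>s\<ge>\<alpha> / 2. \<phi> \<in> hom_sobolev s) \<and> smooth_fun \<phi> \<and>
     (\<exists>C. \<forall>x. \<bar>deriv \<phi> x\<bar> \<le> C * (1 + \<bar>x\<bar>) powr (- 1 - \<alpha>)) \<and>
     (\<exists>C. \<forall>x. \<bar>\<phi> x - sgn x\<bar> \<le> C * (1 + \<bar>x\<bar>) powr (- \<alpha>)) \<and>
     (\<forall>s\<ge>0. deriv \<phi> \<in> hom_sobolev s) \<and>
     (\<forall>h\<in>sobolev \<alpha>. L2_inner (lin_op \<alpha> \<phi> h) h \<ge> 0) \<and>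
     (AE x in lborel. lin_op \<alpha> \<phi> (deriv \<phi>) x = 0) \<and>
     (\<forall>x. deriv \<phi> x > 0) \<and> (\<forall>x. - 1 < \<phi> x \<and> \<phi> x < 1)"

text \<open>These facts follow from the properties of the kink; they are kept separate because they
  concern the operator only.\<close>

definition lin_op_spectral_facts :: "real \<Rightarrow> (real \<Rightarrow> real) \<Rightarrow> bool" where
  "lin_op_spectral_facts \<alpha> \<phi> \<longleftrightarrow>
     self_adjoint_on (sobolev \<alpha>) (lin_op \<alpha> \<phi>) \<and>
     essential_spectrum (sobolev \<alpha>) (lin_op \<alpha> \<phi>) = {2..} \<and>
     0 \<in> eigenvalues (sobolev \<alpha>) (lin_op \<alpha> \<phi>) \<and>
     (\<forall>\<mu>\<in>eigenvalues (sobolev \<alpha>) (lin_op \<alpha> \<phi>). 0 \<le> \<mu>) \<and>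
     (\<forall>h\<in>sobolev \<alpha>. (AE x in lborel. lin_op \<alpha> \<phi> h x = 0) \<longrightarrow>
        (\<exists>c. AE x in lborel. h x = c * deriv \<phi> x))"

end

theory Submission
  imports Defs
begin

text \<open>The sliding method. For large \<open>t\<close> the translate \<open>u (x + t)\<close> lies above \<open>\<phi> x\<close>: at a negative
  minimum of the difference the principal value would be nonpositive, but one of the two functions
  is near \<open>\<plusminus>1\<close> there, where the nonlinearity \<open>s - s\<^sup>3\<close> is strictly decreasing. Lower \<open>t\<close> to the least
  value \<open>\<tau>\<close> for which this order holds. If the graphs did not touch at \<open>\<tau>\<close>, then \<open>t\<close> could be lowered
  further, by uniform continuity on a compact interval and the minimum argument outside it. At a
  touching point both principal values agree, so the nonnegative difference vanishes identically
  and \<open>\<phi>\<close> is a translate of \<open>u\<close>. Both are odd and \<open>\<phi>\<close> is strictly increasing, so \<open>\<tau> = 0\<close>.\<close>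

section \<open>Integrability against the kernel of the fractional operator\<close>

definition levy_weight :: "real \<Rightarrow> real \<Rightarrow> real" where
  "levy_weight \<alpha> z = min 1 (z\<^sup>2) / \<bar>z\<bar> powr (1 + \<alpha>)"

lemma levy_weight_nonneg: "0 \<le> levy_weight \<alpha> z"
  by (simp add: levy_weight_def)

text \<open>Bridge from gauge integrals, used for the powers below, to Bochner integrals:
  nonnegativity gives absolute integrability, and Borel measurability removes the completion of
  \<open>lborel\<close>.\<close>

lemma integrable_lborel_indicator_nonneg:
  fixes f :: "real \<Rightarrow> real"
  assumes [measurable]: "f \<in> borel_measurable borel" "S \<in> sets borel"
    and "\<And>x. x \<in> S \<Longrightarrow> 0 \<le> f x" and "f integrable_on S"
  shows "integrable lborel (\<lambda>x. indicator S x * f x)"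
proof -
  have "set_integrable lebesgue S f"
    using assms by (intro nonnegative_absolutely_integrable_1) auto
  then have "integrable (completion lborel) (\<lambda>x. indicator S x * f x)"
    by (simp add: set_integrable_def)
  then show ?thesis
    by (subst (asm) integrable_completion) auto
qed

lemma integrable_lborel_even:
  fixes f :: "real \<Rightarrow> real"
  assumes "integrable lborel (\<lambda>x. indicator {0<..} x * f x)"
    and "\<And>x. f (- x) = f x" and "f 0 = 0"
  shows "integrable lborel f"
proof -
  have "integrable lborel (\<lambda>x. indicator {0<..} (0 + (-1) * x) * f (0 + (-1) * x))"
    using lborel_integrable_real_affine[OF assms(1), of "-1" 0] by simp
  then have "integrable lborel (\<lambda>x. indicator {0<..} x * f x + indicator {0<..} (- x) * f x)"
    using assms(1,2) by (intro Bochner_Integration.integrable_add) auto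
  also have "(\<lambda>x. indicator {0<..} x * f x + indicator {0<..} (- x) * f x) = f"
    using assms(3) by (auto simp: fun_eq_iff indicator_def not_less)
  finally show ?thesis .
qed

text \<open>For positive \<open>z\<close> the weight is at most \<open>z powr (1 - \<alpha>)\<close>
  near 0, integrable as \<open>\<alpha> < 2\<close>, and at most
  \<open>z powr (- 1 - \<alpha>)\<close> near infinity, integrable as
  \<open>0 < \<alpha>\<close>.\<close>

lemma integrable_levy_weight:
  assumes "0 < \<alpha>" "\<alpha> < 2"
  shows "integrable lborel (levy_weight \<alpha>)"
proof (rule integrable_lborel_even)
  have near: "integrable lborel (\<lambda>z. indicator {0<..1} z * z powr (1 - \<alpha>))"
    using assms by (intro integrable_lborel_indicator_nonneg integrable_on_powr_from_0') auto
  have "(\<lambda>z. z powr (- 1 - \<alpha>)) integrable_on {1..}"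
    using has_integral_powr_to_inf[of "- 1 - \<alpha>" 1] assms by (auto simp: integrable_on_def)
  then have far: "integrable lborel (\<lambda>z. indicator {1..} z * z powr (- 1 - \<alpha>))"
    by (intro integrable_lborel_indicator_nonneg) auto
  show "integrable lborel (\<lambda>z. indicator {0<..} z * levy_weight \<alpha> z)"
  proof (rule Bochner_Integration.integrable_bound[OF Bochner_Integration.integrable_add[OF near far]])
    show "(\<lambda>z. indicator {0<..} z * levy_weight \<alpha> z) \<in> borel_measurable lborel"
      unfolding levy_weight_def by measurable
    show "AE z in lborel. norm (indicator {0<..} z * levy_weight \<alpha> z) \<le>
        norm (indicator {0<..1} z * z powr (1 - \<alpha>) + indicator {1..} z * z powr (- 1 - \<alpha>))"
    proof (rule AE_I2)
      fix z :: real
      consider "z \<le> 0" | "0 < z" "z \<le> 1" | "1 < z" by linarith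
      then show "norm (indicator {0<..} z * levy_weight \<alpha> z) \<le>
        norm (indicator {0<..1} z * z powr (1 - \<alpha>) + indicator {1..} z * z powr (- 1 - \<alpha>))"
      proof cases
        case 2
        have "levy_weight \<alpha> z \<le> z powr 2 / z powr (1 + \<alpha>)"
          using 2 by (simp add: levy_weight_def divide_right_mono)
        also have "\<dots> = z powr (1 - \<alpha>)"
          by (simp flip: powr_diff)
        finally show ?thesis
          using 2 levy_weight_nonneg[of \<alpha> z] by (auto simp: indicator_def)
      next
        case 3
        have "levy_weight \<alpha> z \<le> 1 / z powr (1 + \<alpha>)"
          using 3 by (simp add: levy_weight_def divide_right_mono)
        also have "\<dots> = z powr (- (1 + \<alpha>))"
          by (simp only: powr_minus_divide)
        finally show ?thesis
          using 3 levy_weight_nonneg[of \<alpha> z] by (simp add: indicator_def)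
      qed simp
    qed
  qed
qed (simp_all add: levy_weight_def)

section \<open>Existence of the principal value\<close>

text \<open>Reflection equates the integral with its own negative; a nonintegrable \<open>f\<close>
  is covered because its integral is 0 by convention.\<close>

lemma lborel_integral_odd_eq_0:
  fixes f :: "real \<Rightarrow> real"
  assumes "\<And>x. f (- x) = - f x"
  shows "(LINT x|lborel. f x) = 0"
proof -
  have "(LINT x|lborel. f x) = (LINT x|lborel. f (- x))"
    using lborel_integral_real_affine[of "-1" f 0] by simp
  then show ?thesis
    by (simp add: assms)
qed

text \<open>First-order Taylor expansion: up to distance 1 the Lipschitz derivative makes the
  remainder quadratic, beyond it boundedness suffices. The linear term is cut off to stay bounded;
  being odd in \<open>z\<close>, it will drop out of symmetric integrals.\<close>

lemma C11_loc_remainder_bound: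
  assumes "u \<in> C11_loc" and B: "\<And>y. \<bar>u y\<bar> \<le> B"
  obtains C where "0 \<le> C" and
    "\<And>z. \<bar>u x - u (x + z) + deriv u x * (indicator {-1..1} z * z)\<bar> \<le> C * min 1 (z\<^sup>2)"
proof -
  have der: "(u has_real_derivative deriv u y) (at y)" for y
    using assms(1) by (simp add: C11_loc_def DERIV_deriv_iff_real_differentiable)
  obtain L where L: "L-lipschitz_on {x - 1..x + 1} (deriv u)"
    using assms(1) unfolding C11_loc_def by blast
  then have "0 \<le> L"
    by (rule lipschitz_on_nonneg)
  show ?thesis
  proof (rule that[of "max L (2 * B)"])
    show "0 \<le> max L (2 * B)"
      using \<open>0 \<le> L\<close> by simp
    fix z :: real
    show "\<bar>u x - u (x + z) + deriv u x * (indicator {-1..1} z * z)\<bar> \<le> max L (2 * B) * min 1 (z\<^sup>2)"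
    proof (cases "z \<in> {-1..1}")
      case True
      have bound: "\<bar>deriv u y - deriv u x\<bar> \<le> L * \<bar>z\<bar>" if "y \<in> closed_segment x (x + z)" for y
      proof -
        have "\<bar>y - x\<bar> \<le> \<bar>z\<bar>"
          using that by (auto simp: closed_segment_eq_real_ivl split: if_splits)
        moreover have "y \<in> {x - 1..x + 1}"
          using calculation True by auto
        ultimately have "\<bar>deriv u y - deriv u x\<bar> \<le> L * \<bar>y - x\<bar>"
          using lipschitz_onD[OF L, of y x] by (simp add: dist_real_def)
        also have "\<dots> \<le> L * \<bar>z\<bar>"
          using \<open>0 \<le> L\<close> \<open>\<bar>y - x\<bar> \<le> \<bar>z\<bar>\<close> by (rule mult_left_mono[rotated])
        finally show ?thesis .
      qed
      \<comment> \<open>Mean value inequality for \<open>\<lambda>y. u y - deriv u x * y\<close>,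
        whose derivative is bounded by \<open>L * \<bar>z\<bar>\<close> on the segment.\<close>
      have "norm ((u x - deriv u x * x) - (u (x + z) - deriv u x * (x + z))) \<le> L * \<bar>z\<bar> * norm (x - (x + z))"
        by (rule field_differentiable_bound[where S = "closed_segment x (x + z)"
              and f = "\<lambda>y. u y - deriv u x * y" and f' = "\<lambda>y. deriv u y - deriv u x"])
          (use bound in \<open>auto intro!: derivative_eq_intros DERIV_subset[OF der]\<close>)
      then have "\<bar>u x - u (x + z) + deriv u x * z\<bar> \<le> L * z\<^sup>2"
        by (simp add: algebra_simps power2_eq_square)
      also have "\<dots> \<le> max L (2 * B) * min 1 (z\<^sup>2)"
        using True abs_square_le_1[of z] by (simp add: min_absorb2 mult_right_mono abs_le_iff)
      finally show ?thesis
        using True by simp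
    next
      case False
      then have "1 \<le> z\<^sup>2"
        using abs_square_le_1[of z] by (auto simp: abs_le_iff not_le)
      moreover have "\<bar>u x - u (x + z)\<bar> \<le> 2 * B"
        using B[of x] B[of "x + z"] by linarith
      ultimately show ?thesis
        using False by simp
    qed
  qed
qed

text \<open>The truncated principal value, recentred at the base point.\<close>

definition trunc_pv :: "real \<Rightarrow> (real \<Rightarrow> real) \<Rightarrow> real \<Rightarrow> real \<Rightarrow> real" where
  "trunc_pv \<alpha> u x \<epsilon> = (LINT z:{z. \<epsilon> < \<bar>z\<bar>}|lborel. (u x - u (x + z)) / \<bar>z\<bar> powr (1 + \<alpha>))"

text \<open>The substitution \<open>y = x + z\<close> frees the domain from the base point, so that
  two functions can be compared at different points.\<close>

lemma Dpv_eq_Lim_trunc_pv: "Dpv \<alpha> u x = C_alpha \<alpha> * Lim (at_right 0) (trunc_pv \<alpha> u x)"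
proof -
  have "(LINT y:{y. \<epsilon> < \<bar>x - y\<bar>}|lborel. (u x - u y) / \<bar>x - y\<bar> powr (1 + \<alpha>)) = trunc_pv \<alpha> u x \<epsilon>" for \<epsilon>
    unfolding trunc_pv_def set_lebesgue_integral_def
    by (subst lborel_integral_real_affine[where c = 1 and t = x])
      (auto intro!: Bochner_Integration.integral_cong simp: indicator_def)
  then show ?thesis
    by (simp add: Dpv_def)
qed

text \<open>Away from the singularity \<open>min 1 (z\<^sup>2)\<close> is at least
  \<open>min 1 (\<epsilon>\<^sup>2)\<close>, so a multiple of \<open>levy_weight\<close>
  dominates.\<close>

lemma set_integrable_over_powr:
  fixes \<alpha> \<epsilon> B :: real and f :: "real \<Rightarrow> real"
  assumes "0 < \<alpha>" "\<alpha> < 2" "0 < \<epsilon>"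
    and [measurable]: "f \<in> borel_measurable borel" and B: "\<And>z. \<bar>f z\<bar> \<le> B"
  shows "set_integrable lborel {z. \<epsilon> < \<bar>z\<bar>} (\<lambda>z. f z / \<bar>z\<bar> powr (1 + \<alpha>))"
  unfolding set_integrable_def
proof (rule Bochner_Integration.integrable_bound)
  let ?m = "min 1 (\<epsilon>\<^sup>2)"
  show "integrable lborel (\<lambda>z. B / ?m * levy_weight \<alpha> z)"
    using integrable_levy_weight[OF assms(1,2)] by simp
  show "(\<lambda>z. indicator {z. \<epsilon> < \<bar>z\<bar>} z *\<^sub>R (f z / \<bar>z\<bar> powr (1 + \<alpha>))) \<in> borel_measurable lborel"
    by measurable
  have "0 \<le> B"
    using B[of 0] by linarith
  show "AE z in lborel. norm (indicator {z. \<epsilon> < \<bar>z\<bar>} z *\<^sub>R (f z / \<bar>z\<bar> powr (1 + \<alpha>)))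
      \<le> norm (B / ?m * levy_weight \<alpha> z)"
  proof (rule AE_I2)
    fix z :: real
    show "norm (indicator {z. \<epsilon> < \<bar>z\<bar>} z *\<^sub>R (f z / \<bar>z\<bar> powr (1 + \<alpha>)))
      \<le> norm (B / ?m * levy_weight \<alpha> z)"
    proof (cases "\<epsilon> < \<bar>z\<bar>")
      case True
      then have "?m \<le> min 1 (z\<^sup>2)"
        using assms(3) power_mono[of \<epsilon> "\<bar>z\<bar>" 2] by (simp add: min.coboundedI2)
      then have "1 \<le> min 1 (z\<^sup>2) / ?m"
        using assms(3) by (simp add: le_divide_eq del: min.bounded_iff)
      then have "\<bar>f z\<bar> \<le> B * (min 1 (z\<^sup>2) / ?m)"
        using B[of z] mult_left_mono[OF _ \<open>0 \<le> B\<close>, of 1 "min 1 (z\<^sup>2) / ?m"] by linarith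
      then have "\<bar>f z\<bar> / \<bar>z\<bar> powr (1 + \<alpha>) \<le> B * (min 1 (z\<^sup>2) / ?m) / \<bar>z\<bar> powr (1 + \<alpha>)"
        by (rule divide_right_mono) simp
      also have "\<dots> = B / ?m * levy_weight \<alpha> z"
        by (simp add: levy_weight_def)
      finally have "\<bar>f z\<bar> / \<bar>z\<bar> powr (1 + \<alpha>) \<le> \<bar>B / ?m * levy_weight \<alpha> z\<bar>"
        by (rule order_trans) (rule abs_ge_self)
      then show ?thesis
        using True by simp
    qed simp
  qed
qed

text \<open>Adding the odd linear term changes no truncated integral but makes the integrand bounded
  by a multiple of \<open>levy_weight\<close>; then dominated convergence applies. Only an existing
  limit gives \<open>Lim\<close> in \<open>Dpv\<close> a meaning.\<close>

lemma trunc_pv_tendsto_ex: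
  assumes "0 < \<alpha>" "\<alpha> < 2"
    and "u \<in> C11_loc" and B: "\<And>y. \<bar>u y\<bar> \<le> B"
  shows "\<exists>L. (trunc_pv \<alpha> u x \<longlongrightarrow> L) (at_right 0)"
proof -
  have "continuous_on UNIV u"
    using assms(3) by (auto simp: C11_loc_def intro: differentiable_imp_continuous_within
        intro!: continuous_at_imp_continuous_on)
  then have [measurable]: "u \<in> borel_measurable borel"
    by (rule borel_measurable_continuous_onI)
  obtain C where "0 \<le> C" and
    C: "\<And>z. \<bar>u x - u (x + z) + deriv u x * (indicator {-1..1} z * z)\<bar> \<le> C * min 1 (z\<^sup>2)"
    using C11_loc_remainder_bound[OF assms(3) B, of x] by blast
  define g where "g z = (u x - u (x + z) + deriv u x * (indicator {-1..1} z * z)) / \<bar>z\<bar> powr (1 + \<alpha>)" for z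
  have [measurable]: "g \<in> borel_measurable borel"
    unfolding g_def by measurable
  have g_bound: "\<bar>g z\<bar> \<le> C * levy_weight \<alpha> z" for z
    using divide_right_mono[OF C, of "\<bar>z\<bar> powr (1 + \<alpha>)" z] by (simp add: g_def levy_weight_def)
  have trunc: "trunc_pv \<alpha> u x \<epsilon> = (LINT z|lborel. indicator {z. \<epsilon> < \<bar>z\<bar>} z * g z)" if "0 < \<epsilon>" for \<epsilon>
  proof -
    let ?S = "{z :: real. \<epsilon> < \<bar>z\<bar>}"
    let ?h = "\<lambda>z. deriv u x * (indicator {-1..1} z * z)"
    have u: "\<bar>u x - u (x + z)\<bar> \<le> 2 * B" for z
      using B[of x] B[of "x + z"] by linarith
    have h: "\<bar>?h z\<bar> \<le> \<bar>deriv u x\<bar>" for z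
      by (auto simp: indicator_def abs_mult intro!: mult_left_le)
    have int_u: "set_integrable lborel ?S (\<lambda>z. (u x - u (x + z)) / \<bar>z\<bar> powr (1 + \<alpha>))"
      by (rule set_integrable_over_powr[OF assms(1,2) that _ u]) measurable
    have int_h: "set_integrable lborel ?S (\<lambda>z. ?h z / \<bar>z\<bar> powr (1 + \<alpha>))"
      by (rule set_integrable_over_powr[OF assms(1,2) that _ h]) measurable
    have "(LINT z:?S|lborel. g z) =
        trunc_pv \<alpha> u x \<epsilon> + (LINT z:?S|lborel. ?h z / \<bar>z\<bar> powr (1 + \<alpha>))"
      unfolding trunc_pv_def g_def add_divide_distrib by (rule set_integral_add(2)[OF int_u int_h])
    also have "(LINT z:?S|lborel. ?h z / \<bar>z\<bar> powr (1 + \<alpha>)) = 0"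
      unfolding set_lebesgue_integral_def by (rule lborel_integral_odd_eq_0) (auto simp: indicator_def)
    finally show ?thesis
      by (simp add: set_lebesgue_integral_def)
  qed
  have "(trunc_pv \<alpha> u x \<longlongrightarrow> (LINT z|lborel. g z)) (at_right 0)"
  proof (rule tendsto_at_right_sequentially[of 0 1])
    fix S :: "nat \<Rightarrow> real"
    assume pos: "\<And>n. 0 < S n" and lim: "S \<longlonglongrightarrow> 0"
    have "(\<lambda>n. LINT z|lborel. indicator {z. S n < \<bar>z\<bar>} z * g z) \<longlonglongrightarrow> (LINT z|lborel. g z)"
    proof (rule integral_dominated_convergence)
      show "integrable lborel (\<lambda>z. C * levy_weight \<alpha> z)"
        using integrable_levy_weight[OF assms(1,2)] by simp
      show "AE z in lborel. (\<lambda>n. indicator {z. S n < \<bar>z\<bar>} z * g z) \<longlonglongrightarrow> g z"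
      proof (rule AE_I2)
        fix z :: real
        show "(\<lambda>n. indicator {z. S n < \<bar>z\<bar>} z * g z) \<longlonglongrightarrow> g z"
        proof (cases "z = 0")
          case True
          then show ?thesis
            by (simp add: g_def)
        next
          case False
          then have "\<forall>\<^sub>F n in sequentially. S n < \<bar>z\<bar>"
            using order_tendstoD(2)[OF lim, of "\<bar>z\<bar>"] by simp
          then have "\<forall>\<^sub>F n in sequentially. indicator {z. S n < \<bar>z\<bar>} z * g z = g z"
            by eventually_elim simp
          then show ?thesis
            by (rule tendsto_eventually)
        qed
      qed
      show "AE z in lborel. norm (indicator {z. S n < \<bar>z\<bar>} z * g z) \<le> C * levy_weight \<alpha> z" for n
        using g_bound \<open>0 \<le> C\<close> by (intro AE_I2) (auto simp: indicator_def levy_weight_nonneg)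
    qed measurable
    then show "(\<lambda>n. trunc_pv \<alpha> u x (S n)) \<longlonglongrightarrow> (LINT z|lborel. g z)"
      by (simp add: trunc[OF pos])
  qed simp
  then show ?thesis ..
qed

section \<open>Comparison principles for the principal value\<close>

text \<open>\<open>W\<close> bounds from below how far the difference of the translates rises above
  its value at \<open>z = 0\<close>. The weak principle takes \<open>W = 0\<close>, the strong one a
  bump.\<close>

lemma trunc_pv_diff_le:
  assumes "0 < \<alpha>" "\<alpha> < 2" "0 < \<epsilon>"
    and contv: "continuous_on UNIV v" and contf: "continuous_on UNIV f"
    and Bv: "\<And>y. \<bar>v y\<bar> \<le> B" and Bf: "\<And>y. \<bar>f y\<bar> \<le> B"
    and W: "\<And>z. W z \<le> v (x + z) - f (y + z) - (v x - f y)"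
    and intW: "set_integrable lborel {z. \<epsilon> < \<bar>z\<bar>} (\<lambda>z. W z / \<bar>z\<bar> powr (1 + \<alpha>))"
  shows "trunc_pv \<alpha> v x \<epsilon> - trunc_pv \<alpha> f y \<epsilon> \<le> - (LINT z:{z. \<epsilon> < \<bar>z\<bar>}|lborel. W z / \<bar>z\<bar> powr (1 + \<alpha>))"
proof -
  have [measurable]: "v \<in> borel_measurable borel" "f \<in> borel_measurable borel"
    using contv contf by (auto intro: borel_measurable_continuous_onI)
  have "\<bar>v x - v (x + z)\<bar> \<le> 2 * B" "\<bar>f y - f (y + z)\<bar> \<le> 2 * B" for z
    using Bv[of x] Bv[of "x + z"] Bf[of y] Bf[of "y + z"] by linarith+
  then have int: "set_integrable lborel {z. \<epsilon> < \<bar>z\<bar>} (\<lambda>z. (v x - v (x + z)) / \<bar>z\<bar> powr (1 + \<alpha>))"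
    "set_integrable lborel {z. \<epsilon> < \<bar>z\<bar>} (\<lambda>z. (f y - f (y + z)) / \<bar>z\<bar> powr (1 + \<alpha>))"
    by (auto intro!: set_integrable_over_powr[OF assms(1-3)])
  have "trunc_pv \<alpha> v x \<epsilon> - trunc_pv \<alpha> f y \<epsilon> = (LINT z:{z. \<epsilon> < \<bar>z\<bar>}|lborel.
      (v x - v (x + z)) / \<bar>z\<bar> powr (1 + \<alpha>) - (f y - f (y + z)) / \<bar>z\<bar> powr (1 + \<alpha>))"
    unfolding trunc_pv_def by (rule set_integral_diff(2)[OF int, symmetric])
  also have "\<dots> \<le> (LINT z:{z. \<epsilon> < \<bar>z\<bar>}|lborel. - (W z / \<bar>z\<bar> powr (1 + \<alpha>)))"
  proof (rule set_integral_mono)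
    show "set_integrable lborel {z. \<epsilon> < \<bar>z\<bar>} (\<lambda>z. - (W z / \<bar>z\<bar> powr (1 + \<alpha>)))"
      using intW by (simp add: set_integrable_def)
    show "(v x - v (x + z)) / \<bar>z\<bar> powr (1 + \<alpha>) - (f y - f (y + z)) / \<bar>z\<bar> powr (1 + \<alpha>)
        \<le> - (W z / \<bar>z\<bar> powr (1 + \<alpha>))" for z
      using divide_right_mono[OF W, of "\<bar>z\<bar> powr (1 + \<alpha>)" z]
      by (simp add: diff_divide_distrib add_divide_distrib)
  qed (rule set_integral_diff(1)[OF int])
  also have "\<dots> = - (LINT z:{z. \<epsilon> < \<bar>z\<bar>}|lborel. W z / \<bar>z\<bar> powr (1 + \<alpha>))"
    by (simp add: set_lebesgue_integral_def)
  finally show ?thesis .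
qed

lemma pv_comparison:
  assumes "0 < \<alpha>" "\<alpha> < 2"
    and contv: "continuous_on UNIV v" and contf: "continuous_on UNIV f"
    and Bv: "\<And>y. \<bar>v y\<bar> \<le> B" and Bf: "\<And>y. \<bar>f y\<bar> \<le> B"
    and min: "\<And>z. v x - f y \<le> v (x + z) - f (y + z)"
    and limv: "(trunc_pv \<alpha> v x \<longlongrightarrow> Lv) (at_right 0)"
    and limf: "(trunc_pv \<alpha> f y \<longlongrightarrow> Lf) (at_right 0)"
  shows "Lv \<le> Lf"
proof -
  have "\<forall>\<^sub>F \<epsilon> in at_right 0. trunc_pv \<alpha> v x \<epsilon> \<le> trunc_pv \<alpha> f y \<epsilon>"
    using eventually_at_right_less[of "0 :: real"]
  proof eventually_elim
    case (elim \<epsilon>)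
    have "trunc_pv \<alpha> v x \<epsilon> - trunc_pv \<alpha> f y \<epsilon> \<le> - (LINT z:{z. \<epsilon> < \<bar>z\<bar>}|lborel. 0 / \<bar>z\<bar> powr (1 + \<alpha>))"
      using trunc_pv_diff_le[OF assms(1,2) elim contv contf Bv Bf, of "\<lambda>_. 0" x y] min
      by (simp add: set_integrable_def)
    then show ?case
      by (simp add: set_lebesgue_integral_def)
  qed
  then show ?thesis
    by (rule tendsto_le[OF trivial_limit_at_right_real limf limv])
qed

text \<open>If the difference exceeded its minimum anywhere, it would do so on an interval away from
  0. That interval lowers every truncated difference with small \<open>\<epsilon>\<close> by a fixed
  amount, against the equality of the limits.\<close>

lemma pv_strong_comparison:
  assumes "0 < \<alpha>" "\<alpha> < 2"
    and contv: "continuous_on UNIV v" and contf: "continuous_on UNIV f"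
    and Bv: "\<And>y. \<bar>v y\<bar> \<le> B" and Bf: "\<And>y. \<bar>f y\<bar> \<le> B"
    and min: "\<And>z. v x - f y \<le> v (x + z) - f (y + z)"
    and limv: "(trunc_pv \<alpha> v x \<longlongrightarrow> L) (at_right 0)"
    and limf: "(trunc_pv \<alpha> f y \<longlongrightarrow> L) (at_right 0)"
  shows "v (x + z) - f (y + z) = v x - f y"
proof (rule ccontr)
  assume "v (x + z) - f (y + z) \<noteq> v x - f y"
  then have pos: "0 < v (x + z) - f (y + z) - (v x - f y)"
    using min[of z] by linarith
  then have "z \<noteq> 0"
    by auto
  define w where "w t = v (x + t) - f (y + t) - (v x - f y)" for t
  have "continuous_on UNIV w"
    unfolding w_def
    by (intro continuous_intros continuous_on_compose2[OF contv] continuous_on_compose2[OF contf]) auto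
  then have "isCont w z"
    by (simp add: continuous_on_eq_continuous_at)
  then obtain d where "d > 0" and d: "\<And>t. \<bar>t - z\<bar> < d \<Longrightarrow> \<bar>w t - w z\<bar> < w z / 2"
    using pos unfolding continuous_at_eps_delta dist_real_def
    by (metis half_gt_zero w_def)
  \<comment> \<open>The bound \<open>\<bar>z\<bar> / 2\<close> confines \<open>\<bar>t\<bar>\<close>
    to between \<open>\<bar>z\<bar> / 2\<close> and \<open>2 * \<bar>z\<bar>\<close> on the
    interval.\<close>
  define r where "r = min (d / 2) (\<bar>z\<bar> / 2)"
  have r: "0 < r" "r < d" "r \<le> \<bar>z\<bar> / 2"
    using \<open>d > 0\<close> \<open>z \<noteq> 0\<close> by (auto simp: r_def)
  define c where "c = w z / 2 / (2 * \<bar>z\<bar>) powr (1 + \<alpha>)"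
  have "0 < c"
    using pos \<open>z \<noteq> 0\<close> by (simp add: c_def w_def)
  \<comment> \<open>The power cancels the kernel, so the bump integrates to \<open>c\<close> times
    the length \<open>2 * r\<close>; \<open>c\<close> is chosen to keep it below
    \<open>w z / 2\<close>.\<close>
  define W where "W t = indicator {z - r..z + r} t * c * \<bar>t\<bar> powr (1 + \<alpha>)" for t
  have W_le: "W t \<le> w t" for t
  proof (cases "t \<in> {z - r..z + r}")
    case True
    then have "\<bar>t\<bar> powr (1 + \<alpha>) \<le> (2 * \<bar>z\<bar>) powr (1 + \<alpha>)"
      using r assms(1) by (intro powr_mono2) auto
    then have "W t \<le> c * (2 * \<bar>z\<bar>) powr (1 + \<alpha>)"
      using True \<open>0 < c\<close> by (simp add: W_def)
    also have "\<dots> = w z / 2"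
      using \<open>z \<noteq> 0\<close> by (simp add: c_def)
    also have "\<dots> \<le> w t"
    proof -
      have "\<bar>t - z\<bar> < d"
        using True r by (auto simp: abs_less_iff)
      from d[OF this] show ?thesis
        by (simp only: abs_less_iff) linarith
    qed
    finally show ?thesis .
  next
    case False
    then show ?thesis
      using min[of t] by (simp add: W_def w_def)
  qed
  have "\<forall>\<^sub>F \<epsilon> in at_right 0. trunc_pv \<alpha> v x \<epsilon> - trunc_pv \<alpha> f y \<epsilon> \<le> - (2 * r * c)"
    using eventually_at_right_less[of "0 :: real"]
      order_tendstoD(2)[OF tendsto_ident_at, of 0 "\<bar>z\<bar> / 2" "{0<..}", simplified, OF \<open>z \<noteq> 0\<close>]
  proof eventually_elim
    case (elim \<epsilon>)
    have eq: "indicator {z. \<epsilon> < \<bar>z\<bar>} t *\<^sub>R (W t / \<bar>t\<bar> powr (1 + \<alpha>)) = indicator {z - r..z + r} t *\<^sub>R c" for t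
      using elim r by (auto simp: indicator_def W_def)
    have int: "integrable lborel (\<lambda>t. indicator {z - r..z + r} t *\<^sub>R c)"
      by (intro integrable_scaleR_left integrable_real_indicator) (auto simp: emeasure_lborel_Icc_eq)
    have "trunc_pv \<alpha> v x \<epsilon> - trunc_pv \<alpha> f y \<epsilon> \<le> - (LINT t:{t. \<epsilon> < \<bar>t\<bar>}|lborel. W t / \<bar>t\<bar> powr (1 + \<alpha>))"
      using W_le int eq
      by (intro trunc_pv_diff_le[OF assms(1,2) elim(1) contv contf Bv Bf])
        (auto simp: set_integrable_def w_def)
    also have "(LINT t:{t. \<epsilon> < \<bar>t\<bar>}|lborel. W t / \<bar>t\<bar> powr (1 + \<alpha>)) = 2 * r * c"
      using r(1) by (simp only: set_lebesgue_integral_def eq) simp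
    finally show ?case .
  qed
  moreover have "((\<lambda>\<epsilon>. trunc_pv \<alpha> v x \<epsilon> - trunc_pv \<alpha> f y \<epsilon>) \<longlongrightarrow> 0) (at_right 0)"
    using tendsto_diff[OF limv limf] by simp
  ultimately have "0 \<le> - (2 * r * c)"
    by (intro tendsto_upperbound) auto
  then show False
    using mult_pos_pos[OF r(1) \<open>0 < c\<close>] by linarith
qed

section \<open>From the kink equation to limits of truncated integrals\<close>

lemma smooth_fun_in_C11_loc:
  assumes "smooth_fun f"
  shows "f \<in> C11_loc"
  unfolding C11_loc_def
proof safe
  have diff: "((deriv ^^ n) f) differentiable (at x)" for n x
    using assms by (simp add: smooth_fun_def)
  show "f differentiable at x" for x
    using diff[of 0] by simp
  have "deriv f differentiable at x" "deriv (deriv f) differentiable at x" for x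
    using diff[of 1] diff[of 2] by (simp_all add: numeral_2_eq_2)
  then have der: "(deriv f has_real_derivative deriv (deriv f) x) (at x)"
    and cont: "continuous_on S (deriv (deriv f))" for x S
    by (auto simp: DERIV_deriv_iff_real_differentiable
        intro: differentiable_imp_continuous_within intro!: continuous_at_imp_continuous_on)
  fix K :: "real set"
  assume "compact K"
  \<comment> \<open>The compact set is enlarged to a ball because the mean value inequality needs a
    convex set.\<close>
  then obtain b where b: "K \<subseteq> cball 0 b"
    using compact_imp_bounded[of K] by (auto simp: bounded_iff subset_iff)
  have "bounded (deriv (deriv f) ` cball 0 b)"
    by (intro compact_imp_bounded compact_continuous_image cont) simp
  then obtain L where L: "\<And>x. x \<in> cball 0 b \<Longrightarrow> norm (deriv (deriv f) x) \<le> L" "0 < L"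
    unfolding bounded_pos by blast
  have "norm (deriv f x - deriv f y) \<le> L * norm (x - y)" if "x \<in> cball 0 b" "y \<in> cball 0 b" for x y
    by (rule field_differentiable_bound[where S = "cball 0 b" and f' = "deriv (deriv f)"])
      (use that L in \<open>auto intro: DERIV_subset[OF der]\<close>)
  then have "L-lipschitz_on K (deriv f)"
    using b L(2) by (intro lipschitz_onI) (auto simp only: dist_norm subset_iff less_imp_le)
  then show "\<exists>L. L-lipschitz_on K (deriv f)" ..
qed

lemma C_alpha_nonneg: "0 \<le> C_alpha \<alpha>"
  unfolding C_alpha_def
  by (intro divide_nonneg_nonneg Bochner_Integration.integral_nonneg) auto

lemma kink_eq_trunc_pv_limit:
  assumes "0 < \<alpha>" "\<alpha> < 2" and u: "u \<in> C11_loc" and "bounded (range u)" and "kink_eq \<alpha> u"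
  obtains L where "(trunc_pv \<alpha> u x \<longlongrightarrow> L) (at_right 0)"
    and "C_alpha \<alpha> * L = u x - u x ^ 3"
proof -
  obtain B where "\<And>y. \<bar>u y\<bar> \<le> B"
    using assms(4) by (auto simp: bounded_iff)
  then obtain L where L: "(trunc_pv \<alpha> u x \<longlongrightarrow> L) (at_right 0)"
    using trunc_pv_tendsto_ex[OF assms(1-3)] by blast
  moreover have "C_alpha \<alpha> * L = u x - u x ^ 3"
    using assms(5) Dpv_eq_Lim_trunc_pv[of \<alpha> u x] tendsto_Lim[OF _ L]
    by (simp add: kink_eq_def algebra_simps power2_eq_square power3_eq_cube)
      (metis add_diff_eq diff_add_cancel eq_iff_diff_eq_0)
  ultimately show ?thesis
    by (rule that)
qed

lemma C11_loc_continuous: "u \<in> C11_loc \<Longrightarrow> continuous_on S u"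
  by (auto simp: C11_loc_def intro: differentiable_imp_continuous_within
      intro!: continuous_at_imp_continuous_on)

section \<open>Sliding one kink over another\<close>

text \<open>\<open>v\<close> is the function that gets translated and \<open>f\<close> the fixed
  one; they become \<open>u\<close> and \<open>\<phi>\<close> in the end.\<close>

locale two_kinks =
  fixes \<alpha> :: real and v f :: "real \<Rightarrow> real"
  assumes \<alpha>: "0 < \<alpha>" "\<alpha> < 2"
    and C11: "v \<in> C11_loc" "f \<in> C11_loc"
    and bdd: "bounded (range v)" "bounded (range f)"
    and eq: "kink_eq \<alpha> v" "kink_eq \<alpha> f"
    and v_lim: "(v \<longlongrightarrow> 1) at_top" "(v \<longlongrightarrow> - 1) at_bot"
    and f_lim: "(f \<longlongrightarrow> 1) at_top" "(f \<longlongrightarrow> - 1) at_bot"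
begin

lemma cont: "continuous_on S v" "continuous_on S f"
  using C11 by (auto intro: C11_loc_continuous)

lemma common_bound: "\<exists>B. (\<forall>y. \<bar>v y\<bar> \<le> B) \<and> (\<forall>y. \<bar>f y\<bar> \<le> B)"
proof -
  obtain B B' where "\<And>y. \<bar>v y\<bar> \<le> B" "\<And>y. \<bar>f y\<bar> \<le> B'"
    using bdd by (auto simp: bounded_iff)
  then have "\<bar>v y\<bar> \<le> max B B'" "\<bar>f y\<bar> \<le> max B B'" for y
    by (auto simp: le_max_iff_disj)
  then show ?thesis
    by blast
qed

text \<open>A kink crosses \<open>1/2\<close>, so its nonlinearity cannot vanish identically, as it
  would if \<open>C_alpha \<alpha>\<close> had the junk value \<open>0\<close>.\<close>

lemma C_alpha_pos: "0 < C_alpha \<alpha>"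
proof (rule ccontr)
  assume "\<not> 0 < C_alpha \<alpha>"
  then have "C_alpha \<alpha> = 0"
    using C_alpha_nonneg[of \<alpha>] by linarith
  then have zero: "v x = 0 \<or> (v x)\<^sup>2 = 1" for x
    using eq(1) by (simp add: kink_eq_def Dpv_def)
  obtain a where a: "v a < 0"
    using order_tendstoD(2)[OF v_lim(2), of 0] by (auto simp: eventually_at_bot_linorder)
  obtain b where b: "\<And>x. b \<le> x \<Longrightarrow> 1 / 2 < v x"
    using order_tendstoD(1)[OF v_lim(1), of "1 / 2"] by (auto simp: eventually_at_top_linorder)
  then have "\<exists>x\<ge>a. x \<le> max a b \<and> v x = 1 / 2"
    using a less_imp_le[OF b[of "max a b"]] by (intro IVT' cont) auto
  then obtain x where "v x = 1 / 2"
    by blast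
  then show False
    using zero[of x] by (auto simp: power2_eq_1_iff)
qed

text \<open>The weak comparison principle, read through the equations. A translate of
  \<open>v\<close> is encoded by letting the base points \<open>x\<close> and \<open>y\<close>
  differ.\<close>

lemma nonlinearity_le_at_min:
  assumes "\<And>z. v x - f y \<le> v (x + z) - f (y + z)"
  shows "v x - v x ^ 3 \<le> f y - f y ^ 3"
proof -
  obtain Lv where Lv: "(trunc_pv \<alpha> v x \<longlongrightarrow> Lv) (at_right 0)" "C_alpha \<alpha> * Lv = v x - v x ^ 3"
    using kink_eq_trunc_pv_limit \<alpha> C11(1) bdd(1) eq(1) by blast
  obtain Lf where Lf: "(trunc_pv \<alpha> f y \<longlongrightarrow> Lf) (at_right 0)" "C_alpha \<alpha> * Lf = f y - f y ^ 3"
    using kink_eq_trunc_pv_limit \<alpha> C11(2) bdd(2) eq(2) by blast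
  obtain B where "\<And>y. \<bar>v y\<bar> \<le> B" "\<And>y. \<bar>f y\<bar> \<le> B"
    using common_bound by blast
  then have "Lv \<le> Lf"
    by (rule pv_comparison[OF \<alpha> cont _ _ assms Lv(1) Lf(1)])
  then show ?thesis
    using mult_left_mono[of Lv Lf "C_alpha \<alpha>"] C_alpha_pos Lv(2) Lf(2) by simp
qed

text \<open>Equal values give equal nonlinearities, hence equal limits after division by
  \<open>C_alpha \<alpha>\<close>; the strong comparison principle then applies.\<close>

lemma eq_if_touching:
  assumes "v x = f y" and min: "\<And>z. f (y + z) \<le> v (x + z)"
  shows "v (x + z) = f (y + z)"
proof -
  obtain Lv where Lv: "(trunc_pv \<alpha> v x \<longlongrightarrow> Lv) (at_right 0)" "C_alpha \<alpha> * Lv = v x - v x ^ 3"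
    using kink_eq_trunc_pv_limit \<alpha> C11(1) bdd(1) eq(1) by blast
  obtain Lf where Lf: "(trunc_pv \<alpha> f y \<longlongrightarrow> Lf) (at_right 0)" "C_alpha \<alpha> * Lf = f y - f y ^ 3"
    using kink_eq_trunc_pv_limit \<alpha> C11(2) bdd(2) eq(2) by blast
  have "Lf = Lv"
    using Lv(2) Lf(2) assms(1) C_alpha_pos by (metis mult_left_cancel less_irrefl)
  obtain B where "\<And>y. \<bar>v y\<bar> \<le> B" "\<And>y. \<bar>f y\<bar> \<le> B"
    using common_bound by blast
  then have "v (x + z) - f (y + z) = v x - f y"
    using min assms(1)
    by (intro pv_strong_comparison[OF \<alpha> cont _ _ _ Lv(1) Lf(1)[unfolded \<open>Lf = Lv\<close>]]) auto
  then show ?thesis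
    using assms(1) by simp
qed

text \<open>The nonlinearity \<open>s - s\<^sup>3\<close> is strictly decreasing where \<open>\<bar>s\<bar> \<ge> 3/5\<close>, which
  excludes a negative minimum of \<open>v (x + t) - f x\<close> there.\<close>

lemma le_shift_if:
  assumes ends: "\<And>x. v (x + t) < f x \<Longrightarrow> 3 / 5 \<le> v (x + t) \<or> f x \<le> - 3 / 5"
  shows "f x \<le> v (x + t)"
proof (rule ccontr)
  define d where "d y = v (y + t) - f y" for y
  assume "\<not> f x \<le> v (x + t)"
  then have "d x < 0"
    by (simp add: d_def)
  have shift: "filterlim (\<lambda>y. y + t) at_top at_top" "filterlim (\<lambda>y. y + t) at_bot at_bot"
    by (auto simp: filterlim_at_top filterlim_at_bot eventually_at_top_linorder eventually_at_bot_linorder)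
      (metis le_diff_eq diff_le_eq)+
  \<comment> \<open>Since \<open>d\<close> tends to 0 at both ends, a negative value forces a global
    minimum, attained on a compact interval.\<close>
  have "(d \<longlongrightarrow> 1 - 1) at_top"
    unfolding d_def by (intro tendsto_diff f_lim filterlim_compose[OF v_lim(1) shift(1)])
  moreover have "(d \<longlongrightarrow> - 1 - (- 1)) at_bot"
    unfolding d_def by (intro tendsto_diff f_lim filterlim_compose[OF v_lim(2) shift(2)])
  ultimately have "\<forall>\<^sub>F y in at_top. d x < d y" "\<forall>\<^sub>F y in at_bot. d x < d y"
    using \<open>d x < 0\<close> by (auto dest: order_tendstoD(1))
  then obtain a b where ab: "\<And>y. y \<le> a \<Longrightarrow> d x < d y" "\<And>y. b \<le> y \<Longrightarrow> d x < d y"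
    unfolding eventually_at_top_linorder eventually_at_bot_linorder by blast
  then have "x \<in> {a..b}"
    by (meson atLeastAtMost_iff less_irrefl nle_le)
  moreover have "continuous_on {a..b} d"
    unfolding d_def by (intro continuous_intros continuous_on_compose2[OF cont(1)[of UNIV]] cont(2)) auto
  ultimately obtain y where y: "y \<in> {a..b}" "\<And>z. z \<in> {a..b} \<Longrightarrow> d y \<le> d z"
    using continuous_attains_inf[of "{a..b}" d] by auto
  have "d y \<le> d z" for z
  proof (cases "z \<in> {a..b}")
    case False
    then have "d x < d z"
      using ab[of z] by auto
    then show ?thesis
      using y(2)[OF \<open>x \<in> {a..b}\<close>] by simp
  qed (rule y(2))
  then have "v (y + t) - f y \<le> v (y + t + z) - f (y + z)" for z
    unfolding d_def by (metis add.assoc add.commute)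
  then have "v (y + t) - v (y + t) ^ 3 \<le> f y - f y ^ 3"
    by (rule nonlinearity_le_at_min)
  \<comment> \<open>Difference of cubes; the first factor is positive, so the quadratic form is at
    most 1.\<close>
  then have "0 \<le> (f y - v (y + t)) * (1 - ((v (y + t))\<^sup>2 + v (y + t) * f y + (f y)\<^sup>2))"
    by (simp add: algebra_simps power2_eq_square power3_eq_cube)
  moreover have lt: "v (y + t) < f y"
    using y(2)[OF \<open>x \<in> {a..b}\<close>] \<open>d x < 0\<close> by (simp add: d_def)
  ultimately have le: "(v (y + t))\<^sup>2 + v (y + t) * f y + (f y)\<^sup>2 \<le> 1"
    by (simp add: zero_le_mult_iff)
  \<comment> \<open>In either case both values have the same sign and modulus at least 3/5, so the
    three terms sum to at least 27/25 > 1.\<close>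
  have sq: "9 / 25 \<le> p * q" if "3 / 5 \<le> p" "3 / 5 \<le> q" for p q :: real
    using mult_mono[OF that] that by simp
  show False
    using ends[OF lt]
  proof
    assume "3 / 5 \<le> v (y + t)"
    then show False
      using le lt sq[of "v (y + t)" "v (y + t)"] sq[of "v (y + t)" "f y"] sq[of "f y" "f y"]
      by (simp add: power2_eq_square)
  next
    assume "f y \<le> - 3 / 5"
    then show False
      using le lt sq[of "- v (y + t)" "- v (y + t)"] sq[of "- v (y + t)" "- f y"] sq[of "- f y" "- f y"]
      by (simp add: power2_eq_square)
  qed
qed

lemma v_ge_ex: "\<exists>M. \<forall>x\<ge>M. 3 / 5 \<le> v x"
  using order_tendstoD(1)[OF v_lim(1), of "3 / 5"]
  by (auto simp: eventually_at_top_linorder intro: less_imp_le)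

lemma f_le_ex: "\<exists>M. \<forall>x\<le>M. f x \<le> - 3 / 5"
  using order_tendstoD(2)[OF f_lim(2), of "- 3 / 5"]
  by (auto simp: eventually_at_bot_linorder intro: less_imp_le)

lemma eq_shift: "\<exists>t. \<forall>x. v (x + t) = f x"
proof -
  obtain M where M: "\<And>x. M \<le> x \<Longrightarrow> 3 / 5 \<le> v x"
    using v_ge_ex by blast
  obtain N where N: "\<And>x. x \<le> N \<Longrightarrow> f x \<le> - 3 / 5"
    using f_le_ex by blast
  define T where "T = {t. \<forall>x. f x \<le> v (x + t)}"
  \<comment> \<open>With this shift the half-lines where \<open>v\<close> is near 1 and where
    \<open>f\<close> is near -1 cover the whole line.\<close>
  have "f x \<le> v (x + (M - N))" for x
  proof (rule le_shift_if)
    show "3 / 5 \<le> v (x + (M - N)) \<or> f x \<le> - 3 / 5" for x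
      using M[of "x + (M - N)"] N[of x] by linarith
  qed
  then have "T \<noteq> {}"
    by (auto simp: T_def)
  have "closed T"
    unfolding T_def
    by (intro closed_Collect_all closed_Collect_le continuous_intros continuous_on_compose2[OF cont(1)[of UNIV]]) auto
  obtain p where p: "0 < f p"
    using order_tendstoD(1)[OF f_lim(1), of 0] by (auto simp: eventually_at_top_linorder)
  obtain q where q: "\<And>x. x \<le> q \<Longrightarrow> v x < 0"
    using order_tendstoD(2)[OF v_lim(2), of 0] by (auto simp: eventually_at_bot_linorder)
  \<comment> \<open>A smaller shift would put a negative value of \<open>v\<close> above the
    positive value \<open>f p\<close>.\<close>
  have "q - p \<le> t" if "t \<in> T" for t
  proof (rule ccontr)
    assume "\<not> q - p \<le> t"
    then have "v (p + t) < 0"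
      by (intro q) simp
    moreover have "f p \<le> v (p + t)"
      using that by (simp add: T_def)
    ultimately show False
      using p by simp
  qed
  then have "bdd_below T"
    by (rule bdd_belowI)
  define \<tau> where "\<tau> = Inf T"
  have "\<tau> \<in> T"
    unfolding \<tau>_def by (rule closed_contains_Inf) fact+
  then have le: "f x \<le> v (x + \<tau>)" for x
    by (simp add: T_def)
  have "\<exists>y. v (y + \<tau>) = f y"
  proof (rule ccontr)
    assume "\<nexists>y. v (y + \<tau>) = f y"
    then have less: "f x < v (x + \<tau>)" for x
      using le[of x] by (metis less_eq_real_def)
    \<comment> \<open>To the right of \<open>R\<close> any shift lowered by at most 1 keeps the
      argument of \<open>v\<close> beyond \<open>M\<close>; to the left of \<open>N\<close>,
      \<open>f\<close> is at most -3/5. The maximum keeps the interval nonempty.\<close>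
    define R where "R = max N (M - \<tau> + 1)"
    have "continuous_on {N..R} (\<lambda>x. v (x + \<tau>) - f x)"
      by (intro continuous_intros continuous_on_compose2[OF cont(1)[of UNIV]] cont(2)) auto
    moreover have "{N..R} \<noteq> {}"
      by (simp add: R_def)
    ultimately obtain y where y: "\<And>x. x \<in> {N..R} \<Longrightarrow> v (y + \<tau>) - f y \<le> v (x + \<tau>) - f x"
      using continuous_attains_inf[OF compact_Icc, of N R "\<lambda>x. v (x + \<tau>) - f x"] by blast
    \<comment> \<open>Contains both \<open>x + \<tau>\<close> and \<open>x + (\<tau> - e)\<close>
      for \<open>x\<close> in \<open>{N..R}\<close>. The tolerance below is the least gap between
      the graphs over that interval.\<close>
    let ?K = "{N + \<tau> - 1..R + \<tau>}"
    have "uniformly_continuous_on ?K v"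
      by (intro compact_uniformly_continuous cont) auto
    then obtain d where "d > 0" and d: "\<And>x x'. x \<in> ?K \<Longrightarrow> x' \<in> ?K \<Longrightarrow> dist x' x < d
        \<Longrightarrow> dist (v x') (v x) < v (y + \<tau>) - f y"
      using less[of y] unfolding uniformly_continuous_on_def by (metis diff_gt_0_iff_gt)
    define e where "e = min (d / 2) 1"
    have e: "0 < e" "e < d" "e \<le> 1"
      using \<open>d > 0\<close> by (auto simp: e_def)
    have "f x \<le> v (x + (\<tau> - e))" for x
    proof (rule le_shift_if)
      fix x
      assume lt: "v (x + (\<tau> - e)) < f x"
      have "x \<notin> {N..R}"
      proof
        assume x: "x \<in> {N..R}"
        then have "dist (v (x + (\<tau> - e))) (v (x + \<tau>)) < v (y + \<tau>) - f y"
          using e by (intro d) (auto simp: dist_real_def)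
        then show False
          using y[OF x] lt by (simp add: dist_real_def abs_less_iff)
      qed
      then consider "x \<le> N" | "M \<le> x + (\<tau> - e)"
        using e by (auto simp: R_def)
      then show "3 / 5 \<le> v (x + (\<tau> - e)) \<or> f x \<le> - 3 / 5"
        using M N by cases auto
    qed
    then have "\<tau> - e \<in> T"
      by (simp add: T_def)
    then have "\<tau> \<le> \<tau> - e"
      unfolding \<tau>_def using \<open>bdd_below T\<close> by (rule cInf_lower)
    then show False
      using e(1) by simp
  qed
  then obtain y where "v (y + \<tau>) = f y" ..
  then have "v (y + \<tau> + z) = f (y + z)" for z
  proof (rule eq_if_touching)
    show "f (y + z) \<le> v (y + \<tau> + z)" for z
      using le[of "y + z"] by (simp add: ac_simps)
  qed
  then have "v (x + \<tau>) = f x" for x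
    by (metis add.commute add.left_commute diff_add_cancel)
  then show ?thesis
    by blast
qed

end

section \<open>Oddness fixes the translation\<close>

theorem theorem3:
  fixes \<alpha> :: real and \<phi> u :: "real \<Rightarrow> real"
  assumes "1 < \<alpha>" and "\<alpha> < 2"
    and "odd_kink \<alpha> \<phi>"
    and "lin_op_spectral_facts \<alpha> \<phi>"
    and "lambda1_gt_1 \<alpha> \<phi> \<or> lin_op_perp_gt_1 \<alpha> \<phi>"
    and "u \<in> C11_loc" and "bounded (range u)"
    and "odd_fun u" and "kink_eq \<alpha> u"
    and "(u \<longlongrightarrow> 1) at_top" and "(u \<longlongrightarrow> - 1) at_bot"
    and "(\<lambda>x. 1 - (u x)\<^sup>2) \<in> L2"
    and "\<forall>x. \<bar>u x\<bar> \<le> 1"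
  shows "\<forall>x. u x = \<phi> x"
proof -
  have kink: "odd_fun \<phi>" "kink_eq \<alpha> \<phi>" "(\<phi> \<longlongrightarrow> 1) at_top" "(\<phi> \<longlongrightarrow> - 1) at_bot"
    "bounded (range \<phi>)" "smooth_fun \<phi>" "\<And>x. 0 < deriv \<phi> x"
    using assms(3) unfolding odd_kink_def by blast+
  interpret two_kinks \<alpha> u \<phi>
    using assms kink smooth_fun_in_C11_loc by unfold_locales auto
  obtain t where t: "\<And>x. u (x + t) = \<phi> x"
    using eq_shift by blast
  have "u 0 = 0" "\<phi> 0 = 0"
    using assms(8) kink(1) by (metis odd_fun_def minus_zero equal_neg_zero)+
  \<comment> \<open>The translation carries the zero of \<open>u\<close> at 0 to a zero of
    \<open>\<phi>\<close> at \<open>- t\<close>, and strict monotonicity allows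
    \<open>\<phi>\<close> only one zero.\<close>
  then have "\<phi> (- t) = \<phi> 0"
    using t[of "- t"] by simp
  moreover have "strict_mono \<phi>"
  proof (rule strict_monoI)
    have "(\<phi> has_real_derivative deriv \<phi> x) (at x)" for x
      using C11(2) by (simp add: C11_loc_def DERIV_deriv_iff_real_differentiable)
    then show "\<phi> x < \<phi> y" if "x < y" for x y
      using that kink(7) by (intro DERIV_pos_imp_increasing[OF that]) blast
  qed
  ultimately have "t = 0"
    by (simp add: strict_mono_eq)
  then show ?thesis
    using t by simp
qed

end
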